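(* Let $\mathcal{A}$ be a family with $\{F_2,F_3,F_6\}\subseteq\mathcal{A}\subseteq\{F_2,F_3,F_5,F_6,F_7\}$. Then $\mathrm{ex}(n,\mathcal{A})=\Theta(n^2)$ as $n\to\infty$.
   Context: A triple system $H=(V,E)$ has a finite vertex set $V$, and $E$ is a set of $3$-element subsets of $V$ (no repeated triples). For a family $\mathcal{H}$ of triple systems, $\mathrm{ex}(n,\mathcal{H})$ is the maximum number of triples in a triple system on $n$ vertices that does not contain (an isomorphic copy of) any member of $\mathcal{H}$ as a (not necessarily induced) subsystem. A special four cycle has four distinct base vertices $v_1,v_2,v_3,v_4$ and four triples $\{w_i,v_i,v_{i+1}\}$, $i=1,2,3,4$ (indices modulo $4$), where the $w_j$ are not necessarily distinct but $w_i\neq v_j$ for all $1\le i,j\le 4$. Up to isomorphism there are seven, $F_1,\dots,F_7$, given by exactly the following coincidences among the $w_j$ (no other coincidences): $F_1$: all $w_j$ different; $F_2$: $w_1=w_2=w_3=w_4$; $F_3$: $w_1=w_2$ and $w_3=w_4$; $F_4$: $w_1=w_3$ and $w_2=w_4$ (the Pasch configuration); $F_5$: $w_1=w_2=w_3$; $F_6$: $w_1=w_3$; $F_7$: $w_1=w_2$. *)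

theory Defs
  imports Complex_Main "HOL-Library.Landau_Symbols"
begin

type_synonym 'a triple_system = "'a set \<times> 'a set set"

abbreviation verts :: "'a triple_system \<Rightarrow> 'a set" where
  "verts H \<equiv> fst H"

abbreviation triples :: "'a triple_system \<Rightarrow> 'a set set" where
  "triples H \<equiv> snd H"

definition triple_system :: "'a triple_system \<Rightarrow> bool" where
  "triple_system H \<longleftrightarrow>
     finite (verts H) \<and> (\<forall>e\<in>triples H. e \<subseteq> verts H \<and> card e = 3)"

definition subsystem :: "'a triple_system \<Rightarrow> 'a triple_system \<Rightarrow> bool" where
  "subsystem G H \<longleftrightarrow>
     triple_system G \<and> verts G \<subseteq> verts H \<and> triples G \<subseteq> triples H"

definition isomorphic :: "'a triple_system \<Rightarrow> 'b triple_system \<Rightarrow> bool" where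
  "isomorphic F G \<longleftrightarrow>
     (\<exists>f. bij_betw f (verts F) (verts G) \<and> (`) f ` triples F = triples G)"

definition contains_copy :: "'a triple_system \<Rightarrow> 'b triple_system \<Rightarrow> bool" where
  "contains_copy H F \<longleftrightarrow> (\<exists>G. subsystem G H \<and> isomorphic F G)"

(* Vertices are drawn from nat, which is no restriction: every finite triple system is
   isomorphic to one on natural numbers. The maximum is over a finite set (at most
   n choose 3 triples), which is nonempty if every member of the family has a triple. *)
definition ex :: "nat \<Rightarrow> 'b triple_system set \<Rightarrow> nat" where
  "ex n \<F> = Max {card (triples H) | H :: nat triple_system.
     triple_system H \<and> card (verts H) = n \<and> (\<forall>F\<in>\<F>. \<not> contains_copy H F)}"

(* Indices run over 0, 1, 2, 3 instead of 1, 2, 3, 4. *)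
definition four_cycle :: "(nat \<Rightarrow> 'a) \<Rightarrow> (nat \<Rightarrow> 'a) \<Rightarrow> 'a triple_system" where
  "four_cycle v w =
     (v ` {..<4} \<union> w ` {..<4}, (\<lambda>i. {w i, v i, v ((i + 1) mod 4)}) ` {..<4})"

definition special_four_cycle :: "'a triple_system \<Rightarrow> bool" where
  "special_four_cycle H \<longleftrightarrow>
     (\<exists>v w. inj_on v {..<4} \<and> (\<forall>i<4. \<forall>j<4. w i \<noteq> v j) \<and> H = four_cycle v w)"

(* Representatives with base vertices 0, 1, 2, 3; the list gives the w's in cyclic order. *)
definition std_four_cycle :: "nat list \<Rightarrow> nat triple_system" where
  "std_four_cycle ws = four_cycle (\<lambda>i. i) (\<lambda>i. ws ! i)"

definition F\<^sub>1 where "F\<^sub>1 = std_four_cycle [4, 5, 6, 7]"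
definition F\<^sub>2 where "F\<^sub>2 = std_four_cycle [4, 4, 4, 4]"
definition F\<^sub>3 where "F\<^sub>3 = std_four_cycle [4, 4, 5, 5]"
definition F\<^sub>4 where "F\<^sub>4 = std_four_cycle [4, 5, 4, 5]"
definition F\<^sub>5 where "F\<^sub>5 = std_four_cycle [4, 4, 4, 5]"
definition F\<^sub>6 where "F\<^sub>6 = std_four_cycle [4, 5, 4, 6]"
definition F\<^sub>7 where "F\<^sub>7 = std_four_cycle [4, 4, 5, 6]"

lemma special_four_cycle_std:
  assumes "length ws = 4" "set ws \<subseteq> {4..}"
  shows "special_four_cycle (std_four_cycle ws)"
proof -
  have "ws ! i \<noteq> j" if "i < 4" "j < 4" for i j
  proof -
    have "ws ! i \<in> {4..}"
      using assms that nth_mem by (metis subset_iff)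
    then show ?thesis using that by auto
  qed
  then show ?thesis
    unfolding special_four_cycle_def std_four_cycle_def
    by (intro exI[of _ "\<lambda>i. i"] exI[of _ "\<lambda>i. ws ! i"]) auto
qed

lemma special_four_cycle_F:
  "\<forall>F\<in>{F\<^sub>1, F\<^sub>2, F\<^sub>3, F\<^sub>4, F\<^sub>5, F\<^sub>6, F\<^sub>7}. special_four_cycle F"
  unfolding F\<^sub>1_def F\<^sub>2_def F\<^sub>3_def F\<^sub>4_def F\<^sub>5_def F\<^sub>6_def F\<^sub>7_def
  by (auto intro!: special_four_cycle_std)

end

theory Submission
  imports Defs
begin

text \<open>
  Upper bound. Two edges in the common link of vertices \<open>u\<close> and \<open>v\<close> give four triples: if the
  edges meet, they form \<open>F\<^sub>2\<close>, and if they are disjoint, they form \<open>F\<^sub>3\<close>. So in a system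
  without \<open>F\<^sub>2\<close> and \<open>F\<^sub>3\<close> each pair \<open>{u, v}\<close> has at most one edge in its common link
  (\<open>links_share_at_most_one_edge\<close>). Now count the configurations of a pair \<open>p\<close> together with two
  triples \<open>insert u p\<close>, \<open>insert v p\<close> containing it: there is at most one for each pair \<open>{u, v}\<close>.
  Hence, apart from one triple per pair \<open>p\<close>, the triples number at most \<open>n choose 2\<close>
  (\<open>card_triples_le\<close>), for a total of at most \<open>2 * (n choose 2) \<le> n\<^sup>2\<close>.

  Lower bound. Identify the natural numbers below \<open>2 ^ k\<close> with the vectors of length \<open>k\<close> over
  the field with two elements, addition being bitwise exclusive or, and take all triples of
  distinct vectors with sum zero that avoid the zero vector. Any two vertices of a triple
  determine the third, so no two triples share a pair; this excludes \<open>F\<^sub>2\<close>, \<open>F\<^sub>3\<close>, \<open>F\<^sub>5\<close> and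
  \<open>F\<^sub>7\<close>, each of which has two triples through \<open>{w\<^sub>1, v\<^sub>2}\<close>. In a copy of \<open>F\<^sub>6\<close> the two triples
  through \<open>w\<^sub>1 = w\<^sub>3\<close> give \<open>v\<^sub>1 + v\<^sub>2 = w\<^sub>1 = v\<^sub>3 + v\<^sub>4\<close>, so
  \<open>w\<^sub>2 = v\<^sub>2 + v\<^sub>3 = v\<^sub>4 + v\<^sub>1 = w\<^sub>4\<close>, and the cycle closes up to \<open>F\<^sub>4\<close> instead
  (\<open>xor_triples_free\<close>). Almost every pair of vectors lies in a triple, so there are
  quadratically many of them (\<open>card_xor_triples_quadratic\<close>).
\<close>

section \<open>Copies of a triple system as injections\<close>

lemma contains_copyI:
  assumes "triple_system H" "inj_on f (verts F)"
    and "verts F = \<Union> (triples F)"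
    and "\<And>e. e \<in> triples F \<Longrightarrow> f ` e \<in> triples H"
  shows "contains_copy H F"
proof -
  let ?G = "(f ` verts F, (`) f ` triples F)"
  have sub: "f ` e \<subseteq> verts H" "card (f ` e) = 3" if "e \<in> triples F" for e
    using assms(1) assms(4)[OF that] by (auto simp: triple_system_def)
  have vG: "f ` verts F \<subseteq> verts H"
    using assms(3) sub(1) by blast
  have "finite (f ` verts F)"
    using assms(1) vG finite_subset by (auto simp: triple_system_def)
  then have "triple_system ?G"
    using assms(3) sub(2) by (auto simp: triple_system_def)
  then have "subsystem ?G H"
    using assms(4) vG by (auto simp: subsystem_def)
  moreover have "isomorphic F ?G"
    using assms(2) by (auto simp: isomorphic_def bij_betw_def)
  ultimately show ?thesis
    by (auto simp: contains_copy_def)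
qed

lemma contains_copyE:
  assumes "contains_copy H F"
  obtains f where "inj_on f (verts F)" "\<And>e. e \<in> triples F \<Longrightarrow> f ` e \<in> triples H"
proof -
  from assms obtain G where "subsystem G H" and "isomorphic F G"
    unfolding contains_copy_def by blast
  then obtain f where f: "bij_betw f (verts F) (verts G)" "(`) f ` triples F = triples G"
    and G: "triples G \<subseteq> triples H"
    unfolding subsystem_def isomorphic_def by (elim exE conjE)
  show thesis
  proof (rule that)
    show "inj_on f (verts F)"
      using f(1) by (rule bij_betw_imp_inj_on)
    fix e assume "e \<in> triples F"
    then have "f ` e \<in> triples G"
      unfolding f(2)[symmetric] by (rule imageI)
    then show "f ` e \<in> triples H"
      by (rule subsetD[OF G])
  qed
qed

lemma std_four_cycle_Cons:
  "std_four_cycle [a, b, c, d] =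
     ({0, 1, 2, 3, a, b, c, d}, {{a, 0, 1}, {b, 1, 2}, {c, 2, 3}, {d, 3, 0}})"
proof -
  have "{..<4::nat} = {0, 1, 2, 3}" by auto
  then show ?thesis
    by (auto simp: std_four_cycle_def four_cycle_def simp flip: numeral_2_eq_2)
qed

lemmas four_cycle_unfold = std_four_cycle_Cons F\<^sub>2_def F\<^sub>3_def F\<^sub>5_def F\<^sub>6_def F\<^sub>7_def

section \<open>The upper bound: links share at most one edge\<close>

lemma contains_F2I:
  assumes H: "triple_system H" and "distinct [u, x, v, z, c]"
    and "{c, u, x} \<in> triples H" "{c, x, v} \<in> triples H"
    and "{c, v, z} \<in> triples H" "{c, z, u} \<in> triples H"
  shows "contains_copy H F\<^sub>2"
proof (rule contains_copyI[OF H, where f = "(!) [u, x, v, z, c]"])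
  show "inj_on ((!) [u, x, v, z, c]) (verts F\<^sub>2)"
    by (rule inj_on_nth[OF assms(2)]) (simp add: four_cycle_unfold)
  show "verts F\<^sub>2 = \<Union> (triples F\<^sub>2)"
    by (auto simp: four_cycle_unfold)
  show "(!) [u, x, v, z, c] ` e \<in> triples H" if "e \<in> triples F\<^sub>2" for e
    using that assms(3-6) unfolding four_cycle_unfold by auto
qed

lemma contains_F3I:
  assumes H: "triple_system H" and "distinct [u, x, v, z, c, d]"
    and "{c, u, x} \<in> triples H" "{c, x, v} \<in> triples H"
    and "{d, v, z} \<in> triples H" "{d, z, u} \<in> triples H"
  shows "contains_copy H F\<^sub>3"
proof (rule contains_copyI[OF H, where f = "(!) [u, x, v, z, c, d]"])
  show "inj_on ((!) [u, x, v, z, c, d]) (verts F\<^sub>3)"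
    by (rule inj_on_nth[OF assms(2)]) (simp add: four_cycle_unfold)
  show "verts F\<^sub>3 = \<Union> (triples F\<^sub>3)"
    by (auto simp: four_cycle_unfold)
  show "(!) [u, x, v, z, c, d] ` e \<in> triples H" if "e \<in> triples F\<^sub>3" for e
    using that assms(3-6) unfolding four_cycle_unfold by auto
qed

text \<open>
  The vertices \<open>u\<close> and \<open>v\<close> become opposite base vertices. If \<open>p\<close> and \<open>q\<close> meet, their common
  vertex is the apex of a copy of \<open>F\<^sub>2\<close> and the two other vertices complete the base; if they are
  disjoint, each contributes one base vertex and one apex to a copy of \<open>F\<^sub>3\<close>.
\<close>

lemma links_share_at_most_one_edge:
  assumes H: "triple_system H" and free: "\<not> contains_copy H F\<^sub>2" "\<not> contains_copy H F\<^sub>3"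
    and uv: "u \<noteq> v" and nin: "u \<notin> p \<union> q" "v \<notin> p \<union> q"
    and E: "insert u p \<in> triples H" "insert v p \<in> triples H"
           "insert u q \<in> triples H" "insert v q \<in> triples H"
  shows "p = q"
proof (rule ccontr)
  assume "p \<noteq> q"
  have "card p = 2" "card q = 2"
  proof -
    have card: "card (insert u p) = 3" "card (insert u q) = 3"
      using H E by (auto simp: triple_system_def)
    then have "finite p" "finite q"
      by (metis card.infinite finite_insert zero_neq_numeral)+
    then show "card p = 2" "card q = 2" using card nin by auto
  qed
  then obtain a b c d where p: "p = {a, b}" "a \<noteq> b" and q: "q = {c, d}" "c \<noteq> d"
    by (auto simp: card_2_iff)
  show False
  proof (cases "p \<inter> q = {}")
    case True
    then show False
      using contains_F3I[OF H, of u a v c b d] free uv nin E p q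
      by (auto simp: insert_commute)
  next
    case False
    then obtain s x z where "p = {s, x}" "q = {s, z}" "s \<noteq> x" "s \<noteq> z"
      using p q by blast
    with \<open>p \<noteq> q\<close> show False
      using contains_F2I[OF H, of u x v z s] free uv nin E
      by (auto simp: insert_commute)
  qed
qed

text \<open>
  The double count is carried out by an injection of the triples into two disjoint copies of the
  set of pairs. Each triple is split as \<open>insert (s e) (r e)\<close>, and each pair \<open>p\<close> has a preferred
  vertex \<open>t p\<close> that extends it to a triple. A triple whose removed vertex is the preferred one is
  recovered from \<open>r e\<close>. Any other triple is sent to the pair \<open>{s e, t (r e)}\<close>, whose common link
  contains \<open>r e\<close>; as this is its only edge, it is determined by the pair.
\<close>

lemma card_triples_le:
  fixes V :: "'a set"
  assumes "finite V" and E: "\<And>e. e \<in> E \<Longrightarrow> e \<subseteq> V \<and> card e = 3"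
    and link: "\<And>u v p q. \<lbrakk>u \<noteq> v; u \<notin> p \<union> q; v \<notin> p \<union> q; insert u p \<in> E; insert v p \<in> E;
                 insert u q \<in> E; insert v q \<in> E\<rbrakk> \<Longrightarrow> p = q"
  shows "card E \<le> 2 * (card V choose 2)"
proof -
  define P where "P = {p. p \<subseteq> V \<and> card p = 2}"
  define s where "s e = (SOME x. x \<in> e)" for e :: "'a set"
  define t where "t p = (SOME x. x \<notin> p \<and> insert x p \<in> E)" for p
  define r where "r e = e - {s e}" for e
  have s: "s e \<in> e" if "e \<in> E" for e
    using E[OF that] unfolding s_def by (metis card.empty ex_in_conv someI_ex zero_neq_numeral)
  have ins: "insert (s e) (r e) = e" "s e \<notin> r e" if "e \<in> E" for e
    using s[OF that] by (auto simp: r_def)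
  have t: "t (r e) \<notin> r e \<and> insert (t (r e)) (r e) \<in> E" if "e \<in> E" for e
    unfolding t_def by (rule someI[of _ "s e"]) (use ins[OF that] that in auto)
  have r: "r e \<in> P" if "e \<in> E" for e
    using E[OF that] s[OF that] unfolding P_def r_def by auto
  define \<phi> where "\<phi> e = (if s e = t (r e) then Inl (r e) else Inr {s e, t (r e)})" for e
  have "inj_on \<phi> E"
  proof (rule inj_onI)
    fix e f assume ef: "e \<in> E" "f \<in> E" "\<phi> e = \<phi> f"
    show "e = f"
    proof (cases "s e = t (r e)")
      case True
      then have "r e = r f" "s e = s f"
        using ef by (auto simp: \<phi>_def split: if_splits)
      then show ?thesis using ins ef by metis
    next
      case False
      then have eq: "{s e, t (r e)} = {s f, t (r f)}"
        using ef by (auto simp: \<phi>_def split: if_splits)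
      have "r e = r f"
      proof (rule link[OF False])
        show "s e \<notin> r e \<union> r f" "t (r e) \<notin> r e \<union> r f"
          using ins t ef eq by (metis UnE doubleton_eq_iff)+
        show "insert (s e) (r e) \<in> E" "insert (t (r e)) (r e) \<in> E"
          using ins t ef by auto
        show "insert (s e) (r f) \<in> E" "insert (t (r e)) (r f) \<in> E"
          using ins t ef eq by (metis doubleton_eq_iff)+
      qed
      moreover from this have "s e = s f"
        using eq by (auto simp: doubleton_eq_iff)
      ultimately show ?thesis using ins ef by metis
    qed
  qed
  moreover have "\<phi> ` E \<subseteq> P <+> P"
  proof -
    have "{s e, t (r e)} \<in> P" if "e \<in> E" "s e \<noteq> t (r e)" for e
      using that E[OF that(1)] E[of "insert (t (r e)) (r e)"] t[OF that(1)] s[OF that(1)]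
      unfolding P_def by auto
    then show ?thesis using r by (auto simp: \<phi>_def)
  qed
  moreover have "finite P" unfolding P_def using \<open>finite V\<close> by auto
  ultimately have "card E \<le> card (P <+> P)"
    by (intro card_inj_on_le) auto
  also have "\<dots> = 2 * (card V choose 2)"
    using \<open>finite P\<close> n_subsets[OF \<open>finite V\<close>, of 2] by (simp add: card_Plus P_def)
  finally show ?thesis .
qed

section \<open>The lower bound: triples with vanishing binary sum\<close>

text \<open>
  For \<open>n = 2 ^ k\<close> these are the lines of the projective space of dimension \<open>k - 1\<close> over the field
  with two elements. For other \<open>n\<close> the definition keeps the lines that fit below \<open>n\<close>. The
  vertex 0 lies in no triple, since \<open>z = xor x y\<close> with \<open>x\<close>, \<open>y\<close> or \<open>z\<close> zero makes the other two
  equal.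
\<close>

definition xor_triples :: "nat \<Rightarrow> nat set set" where
  "xor_triples n =
     {{x, y, z} | x y z. distinct [x, y, z] \<and> {x, y, z} \<subseteq> {..<n} \<and> z = xor x y}"

lemma xor_cancel_left: "xor x (xor x y) = y" for x y :: nat
  by (simp flip: xor.assoc)

text \<open>
  The equation \<open>z = xor x y\<close> is symmetric in the three vertices, so it does not depend on the
  order in which they are listed.
\<close>

lemma xor_triplesD:
  assumes "{x, y, z} \<in> xor_triples n"
  shows "z = xor x y"
proof -
  obtain a b c where eq: "{x, y, z} = {a, b, c}" and d: "distinct [a, b, c]" and c: "xor a b = c"
    using assms unfolding xor_triples_def by blast
  have perms: "xor a b = c" "xor b a = c" "xor b c = a" "xor c b = a" "xor a c = b" "xor c a = b"
    unfolding c[symmetric] by (simp_all add: xor_cancel_left xor.commute xor.left_commute)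
  have "card {x, y, z} = 3"
    unfolding eq using d by simp
  then have "distinct [x, y, z]"
    by (auto simp: card_insert_if split: if_splits)
  moreover have "x \<in> {a, b, c}" "y \<in> {a, b, c}" "z \<in> {a, b, c}"
    unfolding eq[symmetric] by simp_all
  ultimately show ?thesis
    using perms by auto
qed

lemma triple_system_xor_triples: "triple_system ({..<n}, xor_triples n)"
  by (auto simp: triple_system_def xor_triples_def)

lemma xor_triples_free:
  assumes "F \<in> {F\<^sub>2, F\<^sub>3, F\<^sub>5, F\<^sub>6, F\<^sub>7}"
  shows "\<not> contains_copy ({..<n}, xor_triples n) F"
proof
  assume "contains_copy ({..<n}, xor_triples n) F"
  then obtain f where inj: "inj_on f (verts F)"
    and E': "\<And>e. e \<in> triples F \<Longrightarrow> f ` e \<in> triples ({..<n}, xor_triples n)"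
    by (rule contains_copyE) blast
  then have E: "\<And>e. e \<in> triples F \<Longrightarrow> f ` e \<in> xor_triples n"
    by simp
  show False
  proof (cases "F = F\<^sub>6")
    case True
    then have "{4, 0, 1} \<in> triples F" "{5, 1, 2} \<in> triples F"
      "{4, 2, 3} \<in> triples F" "{6, 3, 0} \<in> triples F"
      by (simp_all add: four_cycle_unfold)
    from this[THEN E]
    have "{f 1, f 4, f 0} \<in> xor_triples n" "{f 1, f 2, f 5} \<in> xor_triples n"
      "{f 4, f 2, f 3} \<in> xor_triples n" "{f 3, f 0, f 6} \<in> xor_triples n"
      by (simp_all add: insert_commute)
    then have "f 0 = xor (f 1) (f 4)" "f 5 = xor (f 1) (f 2)"
      "f 3 = xor (f 4) (f 2)" "f 6 = xor (f 3) (f 0)"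
      by (auto dest: xor_triplesD)
    \<comment> \<open>Both are the sum of \<open>f 1\<close> and \<open>f 2\<close>, as \<open>f 4\<close> cancels from \<open>f 3\<close> and \<open>f 0\<close>.\<close>
    then have "f 5 = f 6"
      by (simp add: xor.assoc xor.commute xor.left_commute xor_cancel_left)
    then show False
      using inj True by (auto simp: four_cycle_unfold inj_on_def)
  next
    case False
    then have "F \<in> {F\<^sub>2, F\<^sub>3, F\<^sub>5, F\<^sub>7}"
      using assms by blast
    then have mem: "{4, 0, 1} \<in> triples F" "{4, 1, 2} \<in> triples F" "{0, 2} \<subseteq> verts F"
      by (elim insertE emptyE; simp add: four_cycle_unfold)+
    from mem(1,2)[THEN E]
    have "{f 4, f 1, f 0} \<in> xor_triples n" "{f 4, f 1, f 2} \<in> xor_triples n"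
      by (simp_all add: insert_commute)
    then have "f 0 = f 2"
      by (metis xor_triplesD)
    then show False
      using inj mem(3) by (auto dest: inj_onD)
  qed
qed

lemma xor_less_power:
  fixes x y :: nat
  assumes "x < 2 ^ k" "y < 2 ^ k"
  shows "xor x y < 2 ^ k"
proof -
  have "take_bit k (xor x y) = xor x y"
    using assms by (simp add: take_bit_xor take_bit_nat_eq_self)
  then show ?thesis by (metis take_bit_nat_less_exp)
qed

text \<open>
  Every ordered pair of distinct nonzero numbers below \<open>2 ^ k\<close> lies in \<open>e \<times> e\<close> for some triple
  \<open>e\<close>, and each \<open>e \<times> e\<close> has only 9 elements.
\<close>

lemma card_xor_triples_ge:
  assumes "2 ^ k \<le> n"
  shows "(2 ^ k - 1) * (2 ^ k - 2) \<le> 9 * card (xor_triples n)"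
proof -
  let ?D = "SIGMA x:{1..<2 ^ k}. {1..<2 ^ k} - {x :: nat}"
  have fin: "finite (xor_triples n)"
    by (rule finite_subset[of _ "Pow {..<n}"]) (auto simp: xor_triples_def)
  have "?D \<subseteq> (\<Union>e\<in>xor_triples n. e \<times> e)"
  proof
    fix p assume "p \<in> ?D"
    then obtain x y where p: "p = (x, y)"
      and xy: "x \<in> {1..<2 ^ k}" "y \<in> {1..<2 ^ k}" "y \<noteq> x"
      by blast
    have "xor x y \<noteq> x" "xor x y \<noteq> y"
      using xy xor_cancel_left[of x y] xor_cancel_left[of y x] by (auto simp: xor.commute)
    moreover have "xor x y < 2 ^ k"
      using xy by (intro xor_less_power) auto
    ultimately have "{x, y, xor x y} \<in> xor_triples n"
      using xy assms unfolding xor_triples_def by fastforce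
    then show "p \<in> (\<Union>e\<in>xor_triples n. e \<times> e)" unfolding p by blast
  qed
  then have "card ?D \<le> card (\<Union>e\<in>xor_triples n. e \<times> e)"
    using fin by (intro card_mono) (auto simp: xor_triples_def)
  also have "\<dots> \<le> (\<Sum>e\<in>xor_triples n. card (e \<times> e))"
    by (rule card_UN_le[OF fin])
  also have "\<dots> = (\<Sum>e\<in>xor_triples n. 9)"
    using triple_system_xor_triples[of n]
    by (intro sum.cong) (auto simp: triple_system_def card_cartesian_product)
  finally show ?thesis by (simp add: mult.commute flip: numeral_2_eq_2)
qed

text \<open>
  With \<open>M\<close> the largest power of two up to \<open>n\<close>, the bounds \<open>n < 2 * M\<close> and
  \<open>8 * ((M - 1) * (M - 2)) \<ge> 3 * M\<^sup>2\<close>, valid for \<open>M \<ge> 4\<close>, turn the previous estimate into the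
  constant \<open>4 * 8 / 3 * 9 = 96\<close>.
\<close>

lemma card_xor_triples_quadratic:
  assumes "n \<ge> 4"
  shows "n ^ 2 \<le> 96 * card (xor_triples n)"
proof -
  obtain k where k: "2 ^ k \<le> n" "n < 2 ^ (k + 1)"
    using ex_power_ivl1[of 2 n] assms by auto
  define M :: nat where "M = 2 ^ k"
  have M: "M \<le> n" "n < 2 * M" using k by (auto simp: M_def)
  have "k \<ge> 2"
  proof (rule ccontr)
    assume "\<not> k \<ge> 2"
    then have "k = 0 \<or> k = 1" by auto
    then show False using k assms by auto
  qed
  then have "M \<ge> 4" unfolding M_def using power_increasing[of 2 k "2::nat"] by simp
  then obtain m where m: "M = m + 4" by (metis le_add_diff_inverse2)
  have "n ^ 2 \<le> (2 * M) ^ 2" using M by (intro power_mono) auto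
  also have "3 * (2 * M) ^ 2 \<le> 32 * ((M - 1) * (M - 2))"
    unfolding m by (simp add: power2_eq_square algebra_simps)
  then have "3 * (2 * M) ^ 2 \<le> 3 * (96 * card (xor_triples n))"
    using card_xor_triples_ge[OF k(1)] by (simp add: M_def)
  then have "(2 * M) ^ 2 \<le> 96 * card (xor_triples n)" by simp
  finally show ?thesis .
qed

section \<open>The order of magnitude of the extremal number\<close>

text \<open>
  The maximum of an empty or infinite set of numbers says nothing about its members, so even the
  upper bound calls for a witness \<open>H\<close>, and the lower bound for the uniform bound \<open>B\<close>.
\<close>

lemma ex_bounds:
  fixes \<F> :: "'b triple_system set" and H :: "nat triple_system"
  assumes H: "triple_system H" "card (verts H) = n" "\<And>F. F \<in> \<F> \<Longrightarrow> \<not> contains_copy H F"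
    and ub: "\<And>G :: nat triple_system. \<lbrakk>triple_system G; card (verts G) = n;
               \<forall>F\<in>\<F>. \<not> contains_copy G F\<rbrakk> \<Longrightarrow> card (triples G) \<le> B"
  shows "card (triples H) \<le> ex n \<F>" "ex n \<F> \<le> B"
proof -
  let ?S = "{card (triples H) | H :: nat triple_system.
     triple_system H \<and> card (verts H) = n \<and> (\<forall>F\<in>\<F>. \<not> contains_copy H F)}"
  have "?S \<subseteq> {..B}" using ub by auto
  then have fin: "finite ?S" by (rule finite_subset) simp
  have mem: "card (triples H) \<in> ?S" using H by blast
  show "card (triples H) \<le> ex n \<F>"
    unfolding ex_def by (rule Max_ge[OF fin mem])
  show "ex n \<F> \<le> B"
    unfolding ex_def using fin mem \<open>?S \<subseteq> {..B}\<close> by (subst Max_le_iff) auto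
qed

theorem proposition7:
  fixes \<A> :: "nat triple_system set"
  assumes "{F\<^sub>2, F\<^sub>3, F\<^sub>6} \<subseteq> \<A>"
    and "\<A> \<subseteq> {F\<^sub>2, F\<^sub>3, F\<^sub>5, F\<^sub>6, F\<^sub>7}"
  shows "(\<lambda>n. real (ex n \<A>)) \<in> \<Theta>(\<lambda>n. real n ^ 2)"
proof -
  have upper: "card (triples G) \<le> n ^ 2"
    if "triple_system G" "card (verts G) = n" "\<forall>F\<in>\<A>. \<not> contains_copy G F"
    for G :: "nat triple_system" and n
  proof -
    have "card (triples G) \<le> 2 * (card (verts G) choose 2)"
    proof (rule card_triples_le)
      show "p = q" if "u \<noteq> v" "u \<notin> p \<union> q" "v \<notin> p \<union> q" "insert u p \<in> triples G"
        "insert v p \<in> triples G" "insert u q \<in> triples G" "insert v q \<in> triples G" for u v p q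
        using links_share_at_most_one_edge[of G] that \<open>triple_system G\<close> assms(1)
          \<open>\<forall>F\<in>\<A>. \<not> contains_copy G F\<close> by auto
    qed (use \<open>triple_system G\<close> in \<open>auto simp: triple_system_def\<close>)
    also have "\<dots> \<le> n * (n - 1)"
      using \<open>card (verts G) = n\<close> by (simp add: choose_two)
    also have "\<dots> \<le> n ^ 2" by (simp add: power2_eq_square)
    finally show ?thesis .
  qed
  have free: "\<not> contains_copy ({..<n}, xor_triples n) F" if "F \<in> \<A>" for F n
    using xor_triples_free assms(2) that by blast
  have lower_ex: "card (xor_triples n) \<le> ex n \<A>" and upper_ex: "ex n \<A> \<le> n ^ 2" for n
    using ex_bounds[where H = "({..<n}, xor_triples n)" and \<F> = \<A> and n = n,
        OF triple_system_xor_triples _ free upper]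
    by (simp_all only: snd_conv fst_conv card_lessThan)
  show ?thesis
  proof (rule bigthetaI)
    have "norm (real (ex n \<A>)) \<le> 1 * norm (real n ^ 2)" for n
      using upper_ex[of n] by (simp flip: of_nat_power)
    then show "(\<lambda>n. real (ex n \<A>)) \<in> O(\<lambda>n. real n ^ 2)"
      by (intro bigoI[where c = 1] always_eventually allI)
    have "norm (real (ex n \<A>)) \<ge> 1 / 96 * norm (real n ^ 2)" if "n \<ge> 4" for n
    proof -
      have "n ^ 2 \<le> 96 * ex n \<A>"
        using card_xor_triples_quadratic[OF that] lower_ex[of n] by linarith
      then have "real (n ^ 2) \<le> real (96 * ex n \<A>)" by (rule of_nat_mono)
      then show ?thesis by simp
    qed
    then show "(\<lambda>n. real (ex n \<A>)) \<in> \<Omega>(\<lambda>n. real n ^ 2)"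
      by (intro landau_omega.bigI[of "1 / 96"] eventually_sequentiallyI[of 4]) auto
  qed
qed

end
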